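(* Let $E$ be any set. The pair $(\jmath_E, (\mathcal{C}^{\infty}(\mathbb{R}^{E}),\Phi_E))$ is the free $\mathcal{C}^{\infty}$-ring determined by $E$; that is, for every $\mathcal{C}^{\infty}$-ring $(A,\Phi)$ and every function $f:E\to A$ there is a unique $\mathcal{C}^{\infty}$-homomorphism $\widehat f:(\mathcal{C}^{\infty}(\mathbb{R}^{E}),\Phi_E)\to(A,\Phi)$ such that $\widehat f\circ\jmath_E=f$ as functions.
   Context: $\mathbb{N}=\{0,1,2,\dots\}$. A $\mathcal{C}^{\infty}$-structure is a pair $(A,\Phi)$, where $A$ is a set and $\Phi$ assigns to each $n\in\mathbb{N}$ and each smooth function $f\in\mathcal{C}^{\infty}(\mathbb{R}^n,\mathbb{R})$ a function $\Phi(f):A^n\to A$. It is a $\mathcal{C}^{\infty}$-ring if (1) for each $n$ and $k\le n$, the projection $p_k:\mathbb{R}^n\to\mathbb{R}$ onto the $k$-th coordinate is sent to the projection $\pi_k:A^n\to A$ onto the $k$-th coordinate; and (2) whenever $f\in\mathcal{C}^{\infty}(\mathbb{R}^n,\mathbb{R})$, $g_1,\dots,g_n,h\in\mathcal{C}^{\infty}(\mathbb{R}^k,\mathbb{R})$ and $h=f\circ(g_1,\dots,g_n)$, then $\Phi(h)=\Phi(f)\circ(\Phi(g_1),\dots,\Phi(g_n))$. A $\mathcal{C}^{\infty}$-homomorphism $\varphi:(A,\Phi)\to(B,\Psi)$ is a function $\varphi:A\to B$ with $\varphi(\Phi(f)(a_1,\dots,a_n))=\Psi(f)(\varphi(a_1),\dots,\varphi(a_n))$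 for all $n$, all $f\in\mathcal{C}^{\infty}(\mathbb{R}^n,\mathbb{R})$ and all $a_i\in A$. $\mathcal{C}^{\infty}\mathbf{Rng}$ is the category of $\mathcal{C}^{\infty}$-rings and $\mathcal{C}^{\infty}$-homomorphisms. For a finite set $X=\{x_1,\dots,x_n\}$ (with $n$ elements), $\mathbb{R}^X$ is the set of functions $X\to\mathbb{R}$, and $\mathcal{C}^{\infty}(\mathbb{R}^X)$ is the set of functions $\widehat g:\mathbb{R}^X\to\mathbb{R}$, $\widehat g(t)=g(t(x_1),\dots,t(x_n))$, with $g\in\mathcal{C}^{\infty}(\mathbb{R}^n,\mathbb{R})$; its $\mathcal{C}^{\infty}$-ring structure $\Phi_X$ is given by composition, $\Phi_X(f)(\widehat{g_1},\dots,\widehat{g_m})=f\circ(\widehat{g_1},\dots,\widehat{g_m})$; and $\jmath_X:X\to\mathcal{C}^{\infty}(\mathbb{R}^X)$ is $x\mapsto \mathrm{ev}_x$, $\mathrm{ev}_x(t)=t(x)$. For an arbitrary set $E$, $(\mathcal{C}^{\infty}(\mathbb{R}^E),\Phi_E)=\varinjlim_{E'\subseteq_f E}(\mathcal{C}^{\infty}(\mathbb{R}^{E'}),\Phi_{E'})$ is the directed colimit in $\mathcal{C}^{\infty}\mathbf{Rng}$ over the finite subsets $E'$ of $E$ ordered by inclusion, with transition maps $g\mapsto g\circ\mu$, where $\mu:\mathbb{R}^{E''}\to\mathbb{R}^{E'}$ is restriction ($E'\subseteq E''$), and with canonical maps $\ell_{E'}$ into the colimit; $\jmath_E:E\to\mathcal{C}^{\infty}(\mathbb{R}^E)$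 is the unique map with $\jmath_E(x)=\ell_{E'}(\jmath_{E'}(x))$ for all finite $E'\subseteq E$ and $x\in E'$. Equivalently, $\mathcal{C}^{\infty}(\mathbb{R}^E)$ is the set of functions $\mathbb{R}^E\to\mathbb{R}$ that depend smoothly on finitely many variables only, with structure given by composition. *)

theory Defs
  imports "HOL-Analysis.Analysis"
begin

section \<open>Smooth functions on the spaces of n-tuples of reals\<close>

text \<open>
  Throughout, \<open>A\<^sup>X\<close> is rendered as the set \<open>X \<rightarrow>\<^sub>E A\<close> of extensional functions and \<open>A\<^sup>n\<close>
  as \<open>{..<n} \<rightarrow>\<^sub>E A\<close>, so coordinates are numbered from 0.  In particular \<open>A\<^sup>0\<close> has exactly
  one element.  Real powers carry the product topology \<^term>\<open>powertop_real X\<close>.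
\<close>

abbreviation tuples :: "nat \<Rightarrow> 'a set \<Rightarrow> (nat \<Rightarrow> 'a) set" where
  "tuples n A \<equiv> {..<n} \<rightarrow>\<^sub>E A"

abbreviation rpower :: "'e set \<Rightarrow> ('e \<Rightarrow> real) set" where
  "rpower X \<equiv> X \<rightarrow>\<^sub>E UNIV"

definition partial_deriv :: "nat \<Rightarrow> ((nat \<Rightarrow> real) \<Rightarrow> real) \<Rightarrow> (nat \<Rightarrow> real) \<Rightarrow> real" where
  "partial_deriv i f = (\<lambda>x. deriv (\<lambda>t. f (x(i := t))) (x i))"

definition has_partial_deriv_at :: "nat \<Rightarrow> ((nat \<Rightarrow> real) \<Rightarrow> real) \<Rightarrow> (nat \<Rightarrow> real) \<Rightarrow> bool" where
  "has_partial_deriv_at i f x \<longleftrightarrow> (\<lambda>t. f (x(i := t))) field_differentiable at (x i)"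

fun iterated_partial :: "nat list \<Rightarrow> ((nat \<Rightarrow> real) \<Rightarrow> real) \<Rightarrow> (nat \<Rightarrow> real) \<Rightarrow> real" where
  "iterated_partial [] f = f"
| "iterated_partial (i # is) f = partial_deriv i (iterated_partial is f)"

text \<open>Smoothness: the partial derivatives of all orders (order 0 included) exist and are continuous.\<close>

definition smooth :: "nat \<Rightarrow> ((nat \<Rightarrow> real) \<Rightarrow> real) \<Rightarrow> bool" where
  "smooth n f \<longleftrightarrow>
     (\<forall>is. set is \<subseteq> {..<n} \<longrightarrow>
        continuous_map (powertop_real {..<n}) euclideanreal (iterated_partial is f) \<and>
        (\<forall>i<n. \<forall>x\<in>rpower {..<n}. has_partial_deriv_at i (iterated_partial is f) x))"

definition Cinf :: "nat \<Rightarrow> ((nat \<Rightarrow> real) \<Rightarrow> real) set" where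
  "Cinf n = {f \<in> rpower {..<n} \<rightarrow>\<^sub>E UNIV. smooth n f}"


section \<open>The category of smooth rings\<close>

text \<open>
  \<open>oper S n f\<close> is the operation on \<open>(carr S)\<^sup>n\<close> that the structure \<open>S\<close> assigns to \<open>f\<close>; its
  values matter only for \<^term>\<open>f \<in> Cinf n\<close> and arguments in \<open>(carr S)\<^sup>n\<close>.
\<close>

record 'a cinf_struct =
  carr :: "'a set"
  oper :: "nat \<Rightarrow> ((nat \<Rightarrow> real) \<Rightarrow> real) \<Rightarrow> (nat \<Rightarrow> 'a) \<Rightarrow> 'a"

definition cinf_structure :: "'a cinf_struct \<Rightarrow> bool" where
  "cinf_structure S \<longleftrightarrow> (\<forall>n. \<forall>f\<in>Cinf n. oper S n f \<in> tuples n (carr S) \<rightarrow> carr S)"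

definition proj :: "nat \<Rightarrow> nat \<Rightarrow> (nat \<Rightarrow> real) \<Rightarrow> real" where
  "proj n k = (\<lambda>x\<in>rpower {..<n}. x k)"

lemma proj_Cinf:
  assumes "k < n"
  shows "proj n k \<in> Cinf n"
proof -
  have upd: "x(i := t) \<in> rpower {..<n}" if "x \<in> rpower {..<n}" "i < n" for x :: "nat \<Rightarrow> real" and i t
    using that by (auto simp: PiE_iff extensional_def)
  have it: "(\<forall>x\<in>rpower {..<n}. iterated_partial is (proj n k) x = x k) \<or>
      (\<exists>c. \<forall>x\<in>rpower {..<n}. iterated_partial is (proj n k) x = c)"
    if "set is \<subseteq> {..<n}" for "is"
    using that
  proof (induction "is")
    case Nil
    then show ?case by (simp add: proj_def)
  next
    case (Cons i "is")
    then have i: "i < n" and "set is \<subseteq> {..<n}" by auto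
    then consider "\<forall>x\<in>rpower {..<n}. iterated_partial is (proj n k) x = x k"
      | c where "\<forall>x\<in>rpower {..<n}. iterated_partial is (proj n k) x = c"
      using Cons.IH by blast
    then show ?case
    proof cases
      case 1
      then have "\<forall>x\<in>rpower {..<n}. iterated_partial (i # is) (proj n k) x = (if i = k then 1 else 0)"
        using upd i by (simp add: partial_deriv_def)
      then show ?thesis by blast
    next
      case 2
      then have "\<forall>x\<in>rpower {..<n}. iterated_partial (i # is) (proj n k) x = 0"
        using upd i by (simp add: partial_deriv_def)
      then show ?thesis by blast
    qed
  qed
  have "smooth n (proj n k)"
    unfolding smooth_def
  proof (intro allI impI)
    fix "is" :: "nat list" assume "set is \<subseteq> {..<n}"
    from it[OF this] consider "\<forall>x\<in>rpower {..<n}. iterated_partial is (proj n k) x = x k"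
      | c where "\<forall>x\<in>rpower {..<n}. iterated_partial is (proj n k) x = c" by blast
    then show "continuous_map (powertop_real {..<n}) euclideanreal (iterated_partial is (proj n k)) \<and>
        (\<forall>i<n. \<forall>x\<in>rpower {..<n}. has_partial_deriv_at i (iterated_partial is (proj n k)) x)"
    proof cases
      case 1
      have "continuous_map (powertop_real {..<n}) euclideanreal (\<lambda>x. x k)"
        using assms by (intro continuous_map_product_projection) auto
      then have "continuous_map (powertop_real {..<n}) euclideanreal (iterated_partial is (proj n k))"
        by (rule continuous_map_eq) (use 1 in auto)
      moreover have "has_partial_deriv_at i (iterated_partial is (proj n k)) x"
        if "i < n" "x \<in> rpower {..<n}" for i x
        using 1 upd[OF that(2,1)] by (cases "i = k") (simp_all add: has_partial_deriv_at_def)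
      ultimately show ?thesis by blast
    next
      case 2
      have "continuous_map (powertop_real {..<n}) euclideanreal (\<lambda>x. c)" by simp
      then have "continuous_map (powertop_real {..<n}) euclideanreal (iterated_partial is (proj n k))"
        by (rule continuous_map_eq) (use 2 in auto)
      moreover have "has_partial_deriv_at i (iterated_partial is (proj n k)) x"
        if "i < n" "x \<in> rpower {..<n}" for i x
        using 2 upd[OF that(2,1)] by (simp add: has_partial_deriv_at_def)
      ultimately show ?thesis by blast
    qed
  qed
  then show ?thesis unfolding Cinf_def proj_def by auto
qed

definition compose_tuple ::
  "nat \<Rightarrow> nat \<Rightarrow> ((nat \<Rightarrow> real) \<Rightarrow> real) \<Rightarrow> (nat \<Rightarrow> (nat \<Rightarrow> real) \<Rightarrow> real) \<Rightarrow> (nat \<Rightarrow> real) \<Rightarrow> real" where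
  "compose_tuple n k f g = (\<lambda>x\<in>rpower {..<k}. f (\<lambda>i\<in>{..<n}. g i x))"

definition cinf_ring :: "'a cinf_struct \<Rightarrow> bool" where
  "cinf_ring S \<longleftrightarrow>
     cinf_structure S \<and>
     (\<forall>n. \<forall>k<n. \<forall>a\<in>tuples n (carr S). oper S n (proj n k) a = a k) \<and>
     (\<forall>n k. \<forall>f\<in>Cinf n. \<forall>g\<in>tuples n (Cinf k). \<forall>h\<in>Cinf k.
        h = compose_tuple n k f g \<longrightarrow>
        (\<forall>a\<in>tuples k (carr S). oper S k h a = oper S n f (\<lambda>i\<in>{..<n}. oper S k (g i) a)))"

lemma cinf_ring_oper:
  assumes "cinf_ring S" "f \<in> Cinf n" "a \<in> tuples n (carr S)"
  shows "oper S n f a \<in> carr S"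
proof -
  have "cinf_structure S" using assms(1) unfolding cinf_ring_def by (rule conjunct1)
  then have "oper S n f \<in> tuples n (carr S) \<rightarrow> carr S"
    using assms(2) unfolding cinf_structure_def by simp
  then show ?thesis using assms(3) by (rule funcset_mem)
qed

definition cinf_hom :: "'a cinf_struct \<Rightarrow> 'b cinf_struct \<Rightarrow> ('a \<Rightarrow> 'b) set" where
  "cinf_hom S T =
     {\<phi> \<in> carr S \<rightarrow>\<^sub>E carr T.
        \<forall>n. \<forall>f\<in>Cinf n. \<forall>a\<in>tuples n (carr S).
          \<phi> (oper S n f a) = oper T n f (\<lambda>i\<in>{..<n}. \<phi> (a i))}"


section \<open>Directed colimits\<close>

text \<open>
  The directed colimit of a system \<open>S\<close> with transition maps \<open>\<tau> i j\<close> (for \<open>le i j\<close>), in its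
  standard construction: the disjoint union of the carriers, with two elements identified when
  they become equal at a later stage.  An operation is evaluated by representing all the
  arguments at a common stage.  For every directed system of smooth rings this is the colimit
  in their category, with canonical maps \<open>dircolim_in\<close>: see \<open>dircolim_is_colimit\<close>.
\<close>

definition dircolim_rel ::
  "'i set \<Rightarrow> ('i \<Rightarrow> 'i \<Rightarrow> bool) \<Rightarrow> ('i \<Rightarrow> 'a cinf_struct) \<Rightarrow> ('i \<Rightarrow> 'i \<Rightarrow> 'a \<Rightarrow> 'a)
    \<Rightarrow> (('i \<times> 'a) \<times> ('i \<times> 'a)) set" where
  "dircolim_rel I le S \<tau> =
     {((i, a), (j, b)). i \<in> I \<and> a \<in> carr (S i) \<and> j \<in> I \<and> b \<in> carr (S j) \<and>
        (\<exists>k\<in>I. le i k \<and> le j k \<and> \<tau> i k a = \<tau> j k b)}"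

definition dircolim_in ::
  "'i set \<Rightarrow> ('i \<Rightarrow> 'i \<Rightarrow> bool) \<Rightarrow> ('i \<Rightarrow> 'a cinf_struct) \<Rightarrow> ('i \<Rightarrow> 'i \<Rightarrow> 'a \<Rightarrow> 'a)
    \<Rightarrow> 'i \<Rightarrow> 'a \<Rightarrow> ('i \<times> 'a) set" where
  "dircolim_in I le S \<tau> i = (\<lambda>a\<in>carr (S i). dircolim_rel I le S \<tau> `` {(i, a)})"

definition dircolim ::
  "'i set \<Rightarrow> ('i \<Rightarrow> 'i \<Rightarrow> bool) \<Rightarrow> ('i \<Rightarrow> 'a cinf_struct) \<Rightarrow> ('i \<Rightarrow> 'i \<Rightarrow> 'a \<Rightarrow> 'a)
    \<Rightarrow> ('i \<times> 'a) set cinf_struct" where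
  "dircolim I le S \<tau> =
     \<lparr>carr = (SIGMA i:I. carr (S i)) // dircolim_rel I le S \<tau>,
      oper = (\<lambda>n f c. THE z. \<exists>k\<in>I. \<exists>a\<in>tuples n (carr (S k)).
                (\<forall>i<n. c i = dircolim_in I le S \<tau> k (a i)) \<and>
                z = dircolim_in I le S \<tau> k (oper (S k) n f a))\<rparr>"

locale directed_system =
  fixes I :: "'i set" and le :: "'i \<Rightarrow> 'i \<Rightarrow> bool"
    and S :: "'i \<Rightarrow> 'a cinf_struct" and \<tau> :: "'i \<Rightarrow> 'i \<Rightarrow> 'a \<Rightarrow> 'a"
  assumes I_nonempty: "I \<noteq> {}"
    and le_refl: "i \<in> I \<Longrightarrow> le i i"
    and le_trans: "\<lbrakk>i \<in> I; j \<in> I; k \<in> I; le i j; le j k\<rbrakk> \<Longrightarrow> le i k"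
    and le_directed: "\<lbrakk>i \<in> I; j \<in> I\<rbrakk> \<Longrightarrow> \<exists>k\<in>I. le i k \<and> le j k"
    and ring_S: "i \<in> I \<Longrightarrow> cinf_ring (S i)"
    and trans_hom: "\<lbrakk>i \<in> I; j \<in> I; le i j\<rbrakk> \<Longrightarrow> \<tau> i j \<in> cinf_hom (S i) (S j)"
    and trans_id: "\<lbrakk>i \<in> I; a \<in> carr (S i)\<rbrakk> \<Longrightarrow> \<tau> i i a = a"
    and trans_comp: "\<lbrakk>i \<in> I; j \<in> I; k \<in> I; le i j; le j k; a \<in> carr (S i)\<rbrakk>
                      \<Longrightarrow> \<tau> j k (\<tau> i j a) = \<tau> i k a"
begin

abbreviation "L \<equiv> dircolim I le S \<tau>"
abbreviation "lin \<equiv> dircolim_in I le S \<tau>"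
abbreviation "rel \<equiv> dircolim_rel I le S \<tau>"

lemma trans_closed: "\<lbrakk>i \<in> I; j \<in> I; le i j; a \<in> carr (S i)\<rbrakk> \<Longrightarrow> \<tau> i j a \<in> carr (S j)"
  using trans_hom[of i j] unfolding cinf_hom_def by (auto dest: PiE_mem)

lemma oper_closed:
  "\<lbrakk>i \<in> I; f \<in> Cinf n; a \<in> tuples n (carr (S i))\<rbrakk> \<Longrightarrow> oper (S i) n f a \<in> carr (S i)"
  by (rule cinf_ring_oper[OF ring_S])

lemma trans_oper:
  "\<lbrakk>i \<in> I; j \<in> I; le i j; f \<in> Cinf n; a \<in> tuples n (carr (S i))\<rbrakk>
    \<Longrightarrow> \<tau> i j (oper (S i) n f a) = oper (S j) n f (\<lambda>m\<in>{..<n}. \<tau> i j (a m))"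
  using trans_hom[of i j] unfolding cinf_hom_def by simp

lemma equiv_rel: "equiv (SIGMA i:I. carr (S i)) rel"
proof (rule equivI)
  show "rel \<subseteq> (SIGMA i:I. carr (S i)) \<times> (SIGMA i:I. carr (S i))"
    unfolding dircolim_rel_def by auto
  show "refl_on (SIGMA i:I. carr (S i)) rel"
    unfolding dircolim_rel_def refl_on_def using le_refl by auto
  show "sym rel"
  proof (rule symI, clarify)
    fix i a j b assume "((i, a), (j, b)) \<in> rel"
    then obtain k where "i \<in> I" "a \<in> carr (S i)" "j \<in> I" "b \<in> carr (S j)"
      "k \<in> I" "le i k" "le j k" "\<tau> j k b = \<tau> i k a"
      unfolding dircolim_rel_def by auto
    then show "((j, b), (i, a)) \<in> rel"
      unfolding dircolim_rel_def by blast
  qed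
  show "trans rel"
  proof (rule transI, clarify)
    fix i a j b k c
    assume "((i, a), (j, b)) \<in> rel" "((j, b), (k, c)) \<in> rel"
    then obtain p q where
      i: "i \<in> I" "a \<in> carr (S i)" and j: "j \<in> I" "b \<in> carr (S j)" and k: "k \<in> I" "c \<in> carr (S k)"
      and p: "p \<in> I" "le i p" "le j p" "\<tau> i p a = \<tau> j p b"
      and q: "q \<in> I" "le j q" "le k q" "\<tau> j q b = \<tau> k q c"
      unfolding dircolim_rel_def by auto
    obtain r where r: "r \<in> I" "le p r" "le q r" using le_directed[OF p(1) q(1)] by blast
    have "\<tau> i r a = \<tau> k r c"
      using trans_comp[OF i(1) p(1) r(1) p(2) r(2) i(2)] trans_comp[OF j(1) p(1) r(1) p(3) r(2) j(2)]
        trans_comp[OF j(1) q(1) r(1) q(2) r(3) j(2)] trans_comp[OF k(1) q(1) r(1) q(3) r(3) k(2)] p(4) q(4)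
      by simp
    moreover have "le i r" "le k r"
      using le_trans[OF i(1) p(1) r(1) p(2) r(2)] le_trans[OF k(1) q(1) r(1) q(3) r(3)] by auto
    ultimately show "((i, a), (k, c)) \<in> rel"
      unfolding dircolim_rel_def using i k r by blast
  qed
qed

lemma lin_eq_iff:
  assumes "i \<in> I" "a \<in> carr (S i)" "j \<in> I" "b \<in> carr (S j)"
  shows "lin i a = lin j b \<longleftrightarrow> (\<exists>k\<in>I. le i k \<and> le j k \<and> \<tau> i k a = \<tau> j k b)"
proof -
  have "lin i a = lin j b \<longleftrightarrow> ((i, a), (j, b)) \<in> rel"
    using eq_equiv_class_iff[OF equiv_rel, of "(i, a)" "(j, b)"] assms
    unfolding dircolim_in_def by auto
  then show ?thesis using assms unfolding dircolim_rel_def by auto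
qed

lemma lin_closed: "\<lbrakk>i \<in> I; a \<in> carr (S i)\<rbrakk> \<Longrightarrow> lin i a \<in> carr L"
  unfolding dircolim_def dircolim_in_def by (auto intro: quotientI)

lemma lin_cases:
  assumes "c \<in> carr L"
  obtains i a where "i \<in> I" "a \<in> carr (S i)" "c = lin i a"
  using assms unfolding dircolim_def dircolim_in_def by (auto elim!: quotientE)

lemma lin_trans: "\<lbrakk>i \<in> I; j \<in> I; le i j; a \<in> carr (S i)\<rbrakk> \<Longrightarrow> lin j (\<tau> i j a) = lin i a"
  by (subst lin_eq_iff) (auto simp: trans_closed trans_id intro!: bexI[of _ j] le_refl)

lemma finite_bound:
  assumes "finite K" "K \<subseteq> I"
  shows "\<exists>k\<in>I. \<forall>i\<in>K. le i k"
  using assms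
proof (induction K rule: finite_induct)
  case empty
  then show ?case using I_nonempty by auto
next
  case (insert i K)
  then obtain k where k: "k \<in> I" "\<forall>i\<in>K. le i k" by auto
  then obtain l where "l \<in> I" "le i l" "le k l" using le_directed insert.prems by blast
  moreover have "le j l" if "j \<in> K" for j
    using le_trans[of j k l] that insert.prems k calculation by auto
  ultimately show ?case by auto
qed

lemma common_stage:
  assumes "c \<in> tuples n (carr L)"
  obtains k a where "k \<in> I" "a \<in> tuples n (carr (S k))" "\<forall>i<n. c i = lin k (a i)"
proof -
  have "\<forall>m\<in>{..<n}. \<exists>p. fst p \<in> I \<and> snd p \<in> carr (S (fst p)) \<and> c m = lin (fst p) (snd p)"
  proof
    fix m assume "m \<in> {..<n}"
    then have "c m \<in> carr L" using assms by auto
    then obtain i a where "i \<in> I" "a \<in> carr (S i)" "c m = lin i a" by (rule lin_cases)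
    then show "\<exists>p. fst p \<in> I \<and> snd p \<in> carr (S (fst p)) \<and> c m = lin (fst p) (snd p)"
      by (intro exI[of _ "(i, a)"]) simp
  qed
  then obtain p where p: "\<forall>m\<in>{..<n}. fst (p m) \<in> I \<and> snd (p m) \<in> carr (S (fst (p m)))
      \<and> c m = lin (fst (p m)) (snd (p m))"
    by metis
  obtain k where k: "k \<in> I" "\<forall>i\<in>(\<lambda>m. fst (p m)) ` {..<n}. le i k"
    using finite_bound[of "(\<lambda>m. fst (p m)) ` {..<n}"] p by auto
  show ?thesis
  proof (rule that[OF k(1), of "\<lambda>m\<in>{..<n}. \<tau> (fst (p m)) k (snd (p m))"])
    show "(\<lambda>m\<in>{..<n}. \<tau> (fst (p m)) k (snd (p m))) \<in> tuples n (carr (S k))"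
      using p k trans_closed by auto
    show "\<forall>i<n. c i = lin k ((\<lambda>m\<in>{..<n}. \<tau> (fst (p m)) k (snd (p m))) i)"
      using p k lin_trans by auto
  qed
qed

lemma oper_unique:
  assumes k: "k \<in> I" "a \<in> tuples n (carr (S k))" and l: "l \<in> I" "b \<in> tuples n (carr (S l))"
    and eq: "\<forall>i<n. lin k (a i) = lin l (b i)" and f: "f \<in> Cinf n"
  shows "lin k (oper (S k) n f a) = lin l (oper (S l) n f b)"
proof -
  have "\<forall>m\<in>{..<n}. \<exists>q. q \<in> I \<and> le k q \<and> le l q \<and> \<tau> k q (a m) = \<tau> l q (b m)"
  proof
    fix m assume m: "m \<in> {..<n}"
    then have "a m \<in> carr (S k)" "b m \<in> carr (S l)" using k l by auto
    then show "\<exists>q. q \<in> I \<and> le k q \<and> le l q \<and> \<tau> k q (a m) = \<tau> l q (b m)"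
      using eq m lin_eq_iff[OF k(1) _ l(1), of "a m" "b m"] by auto
  qed
  then obtain q where q:
    "\<forall>m\<in>{..<n}. q m \<in> I \<and> le k (q m) \<and> le l (q m) \<and> \<tau> k (q m) (a m) = \<tau> l (q m) (b m)"
    by metis
  obtain r where r: "r \<in> I" "\<forall>i\<in>insert k (insert l (q ` {..<n})). le i r"
    using finite_bound[of "insert k (insert l (q ` {..<n}))"] q k l by auto
  have "(\<lambda>m\<in>{..<n}. \<tau> k r (a m)) = (\<lambda>m\<in>{..<n}. \<tau> l r (b m))"
  proof (rule restrict_ext)
    fix m assume m: "m \<in> {..<n}"
    then have "a m \<in> carr (S k)" "b m \<in> carr (S l)" using k l by auto
    moreover have "q m \<in> I" "le k (q m)" "le l (q m)" "le (q m) r" "\<tau> k (q m) (a m) = \<tau> l (q m) (b m)"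
      using q m r by auto
    ultimately show "\<tau> k r (a m) = \<tau> l r (b m)"
      using trans_comp[OF k(1) _ r(1), of "q m" "a m"] trans_comp[OF l(1) _ r(1), of "q m" "b m"]
      by simp
  qed
  then have "\<tau> k r (oper (S k) n f a) = \<tau> l r (oper (S l) n f b)"
    using trans_oper[OF k(1) r(1) _ f k(2)] trans_oper[OF l(1) r(1) _ f l(2)] r(2) by simp
  then show ?thesis
    using lin_eq_iff[OF k(1) oper_closed[OF k(1) f k(2)] l(1) oper_closed[OF l(1) f l(2)]] r by auto
qed

lemma oper_lin:
  assumes k: "k \<in> I" "a \<in> tuples n (carr (S k))" and c: "\<forall>i<n. c i = lin k (a i)"
    and f: "f \<in> Cinf n"
  shows "oper L n f c = lin k (oper (S k) n f a)"
proof -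
  have "(THE z. \<exists>k\<in>I. \<exists>a\<in>tuples n (carr (S k)). (\<forall>i<n. c i = lin k (a i)) \<and>
          z = lin k (oper (S k) n f a)) = lin k (oper (S k) n f a)"
  proof (rule the_equality)
    show "\<exists>l\<in>I. \<exists>b\<in>tuples n (carr (S l)). (\<forall>i<n. c i = lin l (b i)) \<and>
          lin k (oper (S k) n f a) = lin l (oper (S l) n f b)"
      by (intro bexI[of _ k] bexI[of _ a] conjI refl) (fact k c)+
  next
    fix z
    assume "\<exists>l\<in>I. \<exists>b\<in>tuples n (carr (S l)). (\<forall>i<n. c i = lin l (b i)) \<and>
          z = lin l (oper (S l) n f b)"
    then obtain l b where l: "l \<in> I" "b \<in> tuples n (carr (S l))" "\<forall>i<n. c i = lin l (b i)"
      "z = lin l (oper (S l) n f b)" by (elim bexE conjE)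
    have "\<forall>i<n. lin l (b i) = lin k (a i)" using l(3) c by simp
    then show "z = lin k (oper (S k) n f a)"
      unfolding l(4) by (rule oper_unique[OF l(1,2) k _ f])
  qed
  then show ?thesis unfolding dircolim_def by simp
qed

lemma lin_hom: "i \<in> I \<Longrightarrow> lin i \<in> cinf_hom (S i) L"
  unfolding cinf_hom_def
proof (intro CollectI conjI allI ballI)
  assume i: "i \<in> I"
  show "lin i \<in> carr (S i) \<rightarrow>\<^sub>E carr L"
    by (rule PiE_I) (use i lin_closed in \<open>auto simp: dircolim_in_def\<close>)
  fix n f a assume "f \<in> Cinf n" "a \<in> tuples n (carr (S i))"
  then show "lin i (oper (S i) n f a) = oper L n f (\<lambda>m\<in>{..<n}. lin i (a m))"
    using i by (intro oper_lin[symmetric]) auto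
qed

lemma ring_L: "cinf_ring L"
  unfolding cinf_ring_def cinf_structure_def
proof (intro conjI allI ballI impI)
  fix n f assume f: "f \<in> Cinf n"
  show "oper L n f \<in> tuples n (carr L) \<rightarrow> carr L"
  proof
    fix c assume "c \<in> tuples n (carr L)"
    then obtain k a where "k \<in> I" "a \<in> tuples n (carr (S k))" "\<forall>i<n. c i = lin k (a i)"
      by (rule common_stage)
    then show "oper L n f c \<in> carr L" by (simp add: oper_lin f lin_closed oper_closed)
  qed
next
  fix n k c assume k: "k < n" and c: "c \<in> tuples n (carr L)"
  obtain l a where a: "l \<in> I" "a \<in> tuples n (carr (S l))" "\<forall>i<n. c i = lin l (a i)"
    using c by (rule common_stage)
  show "oper L n (proj n k) c = c k"
  proof -
    have "proj n k \<in> Cinf n" using proj_Cinf k .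
    then have "oper L n (proj n k) c = lin l (oper (S l) n (proj n k) a)" by (rule oper_lin[OF a])
    also have "oper (S l) n (proj n k) a = a k"
      using ring_S[OF a(1)] a(2) k unfolding cinf_ring_def by (elim conjE) simp
    finally show ?thesis using a(3) k by simp
  qed
next
  fix n k f g h c
  assume f: "f \<in> Cinf n" and g: "g \<in> tuples n (Cinf k)" and h: "h \<in> Cinf k"
    and eq: "h = compose_tuple n k f g" and c: "c \<in> tuples k (carr L)"
  obtain l a where a: "l \<in> I" "a \<in> tuples k (carr (S l))" "\<forall>i<k. c i = lin l (a i)"
    using c by (rule common_stage)
  have gi: "g i \<in> Cinf k" if "i < n" for i using g that by auto
  have t: "(\<lambda>i\<in>{..<n}. oper (S l) k (g i) a) \<in> tuples n (carr (S l))"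
    using gi a oper_closed by auto
  have "oper L n f (\<lambda>i\<in>{..<n}. oper L k (g i) c)
      = lin l (oper (S l) n f (\<lambda>i\<in>{..<n}. oper (S l) k (g i) a))"
    by (rule oper_lin[OF a(1) t _ f]) (simp add: oper_lin[OF a] gi)
  also have "oper (S l) n f (\<lambda>i\<in>{..<n}. oper (S l) k (g i) a) = oper (S l) k h a"
    using ring_S[OF a(1)] f g h eq a(2) unfolding cinf_ring_def by (elim conjE) simp
  also have "lin l (oper (S l) k h a) = oper L k h c"
    using oper_lin[OF a h] by simp
  finally show "oper L k h c = oper L n f (\<lambda>i\<in>{..<n}. oper L k (g i) c)" by (rule sym)
qed

theorem dircolim_is_colimit:
  "cinf_ring L"
  "i \<in> I \<Longrightarrow> lin i \<in> cinf_hom (S i) L"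
  "\<lbrakk>i \<in> I; j \<in> I; le i j; a \<in> carr (S i)\<rbrakk> \<Longrightarrow> lin j (\<tau> i j a) = lin i a"
  "\<lbrakk>cinf_ring T; \<And>i. i \<in> I \<Longrightarrow> \<psi> i \<in> cinf_hom (S i) T;
    \<And>i j a. \<lbrakk>i \<in> I; j \<in> I; le i j; a \<in> carr (S i)\<rbrakk> \<Longrightarrow> \<psi> j (\<tau> i j a) = \<psi> i a\<rbrakk>
   \<Longrightarrow> \<exists>!\<phi>. \<phi> \<in> cinf_hom L T \<and> (\<forall>i\<in>I. \<forall>a\<in>carr (S i). \<phi> (lin i a) = \<psi> i a)"
proof -
  show "cinf_ring L" by (rule ring_L)
  show "i \<in> I \<Longrightarrow> lin i \<in> cinf_hom (S i) L" by (rule lin_hom)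
  show "\<lbrakk>i \<in> I; j \<in> I; le i j; a \<in> carr (S i)\<rbrakk> \<Longrightarrow> lin j (\<tau> i j a) = lin i a"
    by (rule lin_trans)
next
  assume T: "cinf_ring T" and \<psi>: "\<And>i. i \<in> I \<Longrightarrow> \<psi> i \<in> cinf_hom (S i) T"
    and compat: "\<And>i j a. \<lbrakk>i \<in> I; j \<in> I; le i j; a \<in> carr (S i)\<rbrakk> \<Longrightarrow> \<psi> j (\<tau> i j a) = \<psi> i a"
  have wd: "\<psi> i a = \<psi> j b"
    if ij: "i \<in> I" "a \<in> carr (S i)" "j \<in> I" "b \<in> carr (S j)" and eq: "lin i a = lin j b" for i a j b
  proof -
    obtain k where k: "k \<in> I" "le i k" "le j k" "\<tau> i k a = \<tau> j k b"
      using eq unfolding lin_eq_iff[OF ij] by blast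
    have "\<psi> i a = \<psi> k (\<tau> i k a)" by (rule compat[symmetric]) (fact ij k)+
    also have "\<dots> = \<psi> j b" unfolding k(4) by (rule compat) (fact ij k)+
    finally show ?thesis .
  qed
  define \<phi> where "\<phi> = (\<lambda>c\<in>carr L. THE z. \<exists>i\<in>I. \<exists>a\<in>carr (S i). c = lin i a \<and> z = \<psi> i a)"
  have val: "\<phi> (lin i a) = \<psi> i a" if ia: "i \<in> I" "a \<in> carr (S i)" for i a
  proof -
    have "(THE z. \<exists>j\<in>I. \<exists>b\<in>carr (S j). lin i a = lin j b \<and> z = \<psi> j b) = \<psi> i a"
    proof (rule the_equality)
      show "\<exists>j\<in>I. \<exists>b\<in>carr (S j). lin i a = lin j b \<and> \<psi> i a = \<psi> j b" using ia by blast
    next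
      fix z assume "\<exists>j\<in>I. \<exists>b\<in>carr (S j). lin i a = lin j b \<and> z = \<psi> j b"
      then obtain j b where "j \<in> I" "b \<in> carr (S j)" "lin i a = lin j b" "z = \<psi> j b" by blast
      then show "z = \<psi> i a" using wd[of j b i a] ia by simp
    qed
    then show ?thesis unfolding \<phi>_def using ia lin_closed by simp
  qed
  have hom: "\<phi> \<in> cinf_hom L T"
    unfolding cinf_hom_def
  proof (intro CollectI conjI allI ballI)
    show "\<phi> \<in> carr L \<rightarrow>\<^sub>E carr T"
    proof (rule PiE_I)
      fix c assume "c \<in> carr L"
      then obtain i a where ia: "i \<in> I" "a \<in> carr (S i)" "c = lin i a" by (rule lin_cases)
      then have "\<psi> i a \<in> carr T" using \<psi>[OF ia(1)] unfolding cinf_hom_def by auto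
      then show "\<phi> c \<in> carr T" using val ia by simp
    qed (simp add: \<phi>_def)
  next
    fix n f c assume f: "f \<in> Cinf n" and c: "c \<in> tuples n (carr L)"
    obtain k a where a: "k \<in> I" "a \<in> tuples n (carr (S k))" "\<forall>i<n. c i = lin k (a i)"
      using c by (rule common_stage)
    have "\<phi> (oper L n f c) = \<psi> k (oper (S k) n f a)"
      using oper_lin[OF a f] val oper_closed[OF a(1) f a(2)] a(1) by simp
    also have "\<dots> = oper T n f (\<lambda>i\<in>{..<n}. \<psi> k (a i))"
      using \<psi>[OF a(1)] f a(2) unfolding cinf_hom_def by simp
    also have "(\<lambda>i\<in>{..<n}. \<psi> k (a i)) = (\<lambda>i\<in>{..<n}. \<phi> (c i))"
    proof (rule restrict_ext)
      fix i assume "i \<in> {..<n}"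
      then show "\<psi> k (a i) = \<phi> (c i)" using val[OF a(1) PiE_mem[OF a(2)]] a(3) by simp
    qed
    finally show "\<phi> (oper L n f c) = oper T n f (\<lambda>i\<in>{..<n}. \<phi> (c i))" .
  qed
  show "\<exists>!\<phi>. \<phi> \<in> cinf_hom L T \<and> (\<forall>i\<in>I. \<forall>a\<in>carr (S i). \<phi> (lin i a) = \<psi> i a)"
  proof (rule ex1I[of _ \<phi>])
    show "\<phi> \<in> cinf_hom L T \<and> (\<forall>i\<in>I. \<forall>a\<in>carr (S i). \<phi> (lin i a) = \<psi> i a)"
      using hom val by blast
  next
    fix \<phi>' assume \<phi>': "\<phi>' \<in> cinf_hom L T \<and> (\<forall>i\<in>I. \<forall>a\<in>carr (S i). \<phi>' (lin i a) = \<psi> i a)"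
    show "\<phi>' = \<phi>"
    proof (rule extensionalityI[of _ "carr L"])
      show "\<phi>' \<in> extensional (carr L)" "\<phi> \<in> extensional (carr L)"
        using \<phi>' hom unfolding cinf_hom_def by (auto simp: PiE_def)
      fix c assume "c \<in> carr L"
      then obtain i a where "i \<in> I" "a \<in> carr (S i)" "c = lin i a" by (rule lin_cases)
      then show "\<phi>' c = \<phi> c" using \<phi>' val by simp
    qed
  qed
qed

end


section \<open>Smooth functions in finitely many and in arbitrarily many variables\<close>

text \<open>\<open>hat X x g\<close> is the function on \<open>\<real>\<^sup>X\<close> induced by \<open>g\<close> along an enumeration \<open>x\<close> of \<open>X\<close>.\<close>

definition hat :: "'e set \<Rightarrow> (nat \<Rightarrow> 'e) \<Rightarrow> ((nat \<Rightarrow> real) \<Rightarrow> real) \<Rightarrow> ('e \<Rightarrow> real) \<Rightarrow> real" where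
  "hat X x g = (\<lambda>t\<in>rpower X. g (\<lambda>i\<in>{..<card X}. t (x i)))"

definition Cinf_fin :: "'e set \<Rightarrow> (('e \<Rightarrow> real) \<Rightarrow> real) cinf_struct" where
  "Cinf_fin X =
     \<lparr>carr = {hat X x g | x g. bij_betw x {..<card X} X \<and> g \<in> Cinf (card X)},
      oper = (\<lambda>m f u. \<lambda>t\<in>rpower X. f (\<lambda>i\<in>{..<m}. u i t))\<rparr>"

definition ev :: "'e set \<Rightarrow> 'e \<Rightarrow> ('e \<Rightarrow> real) \<Rightarrow> real" where
  "ev X = (\<lambda>x\<in>X. \<lambda>t\<in>rpower X. t x)"

definition transition ::
  "'e set \<Rightarrow> 'e set \<Rightarrow> (('e \<Rightarrow> real) \<Rightarrow> real) \<Rightarrow> ('e \<Rightarrow> real) \<Rightarrow> real" where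
  "transition X Y u = (\<lambda>t\<in>rpower Y. u (restrict t X))"

definition Cinf_free :: "'e set \<Rightarrow> ('e set \<times> (('e \<Rightarrow> real) \<Rightarrow> real)) set cinf_struct" where
  "Cinf_free E = dircolim {X. finite X \<and> X \<subseteq> E} (\<subseteq>) Cinf_fin transition"

definition ell :: "'e set \<Rightarrow> 'e set \<Rightarrow> (('e \<Rightarrow> real) \<Rightarrow> real) \<Rightarrow> ('e set \<times> (('e \<Rightarrow> real) \<Rightarrow> real)) set" where
  "ell E = dircolim_in {X. finite X \<and> X \<subseteq> E} (\<subseteq>) Cinf_fin transition"

definition jmath :: "'e set \<Rightarrow> 'e \<Rightarrow> ('e set \<times> (('e \<Rightarrow> real) \<Rightarrow> real)) set" where
  "jmath E = (\<lambda>x\<in>E. THE c. \<forall>X. finite X \<and> X \<subseteq> E \<and> x \<in> X \<longrightarrow> c = ell E X (ev X x))"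

end

theory Submission
  imports Defs
begin

text \<open>
  A smooth function of the coordinates \<open>x 0, \<dots>, x (n - 1)\<close> of \<open>\<real>\<^sup>X\<close> is the value of the
  operation \<open>g\<close> at the evaluations \<open>ev X (x i)\<close>, so a homomorphism extending \<open>f\<close> must send it to
  the value of \<open>g\<close> at the elements \<open>f (x i)\<close> of \<open>A\<close>.  This prescription is independent of the
  presentation and compatible with the transition maps, because any change of variables is a
  composition with projections, which the axioms of a smooth ring respect; the universal property
  of the directed colimit then assembles it over all finite subsets.  That the smooth functions on
  \<open>\<real>\<^sup>X\<close> are closed under the operations at all is the chain rule.
\<close>

section \<open>The chain rule along a curve\<close>

lemma rpower_upd:
  assumes "x \<in> rpower {..<n}" "i < n"
  shows "x(i := t) \<in> rpower {..<n}"
  using assms by (auto simp: PiE_iff extensional_def)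

lemma limitin_powertop:
  assumes "\<And>t. z t \<in> rpower {..<n}" "y \<in> rpower {..<n}"
    and "\<And>i. i < n \<Longrightarrow> ((\<lambda>t. z t i) \<longlongrightarrow> y i) F"
  shows "limitin (powertop_real {..<n}) z y F"
  using assms by (auto simp: limitin_componentwise PiE_iff)

lemma continuous_map_tendsto:
  assumes "continuous_map (powertop_real {..<n}) euclideanreal f"
    and "\<And>t. z t \<in> rpower {..<n}" "y \<in> rpower {..<n}"
    and "\<And>i. i < n \<Longrightarrow> ((\<lambda>t. z t i) \<longlongrightarrow> y i) F"
  shows "((\<lambda>t. f (z t)) \<longlongrightarrow> f y) F"
proof -
  have "limitin (powertop_real {..<n}) z y F" by (rule limitin_powertop) (use assms in auto)
  from continuous_map_limit[OF assms(1) this] show ?thesis by (simp add: o_def)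
qed

text \<open>The mean value theorem on one coordinate line. The bound with absolute values covers
  both orders of \<open>a\<close> and \<open>b\<close>, and it squeezes \<open>s\<close> to
  \<open>a\<close> when \<open>b\<close> tends to \<open>a\<close>.\<close>

lemma partial_deriv_mean_value:
  assumes "\<And>x. x \<in> rpower {..<n} \<Longrightarrow> has_partial_deriv_at p f x"
    and z: "z \<in> rpower {..<n}" and p: "p < n"
  shows "\<exists>s. \<bar>s - a\<bar> \<le> \<bar>b - a\<bar> \<and>
    f (z(p := b)) - f (z(p := a)) = (b - a) * partial_deriv p f (z(p := s))"
proof -
  have D: "((\<lambda>t. f (z(p := t))) has_real_derivative partial_deriv p f (z(p := s))) (at s)" for s
    using assms(1)[OF rpower_upd[OF z p]]
    by (simp add: has_partial_deriv_at_def partial_deriv_def DERIV_deriv_iff_field_differentiable)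
  consider "a < b" | "a = b" | "b < a" by linarith
  then show ?thesis
  proof cases
    case 1
    from MVT2[OF 1 D] obtain s where "a < s" "s < b"
      "f (z(p := b)) - f (z(p := a)) = (b - a) * partial_deriv p f (z(p := s))" by blast
    then show ?thesis by (intro exI[of _ s]) auto
  next
    case 3
    from MVT2[OF 3 D] obtain s where "b < s" "s < a"
      "f (z(p := a)) - f (z(p := b)) = (a - b) * partial_deriv p f (z(p := s))" by blast
    then show ?thesis by (intro exI[of _ s]) (auto simp: algebra_simps)
  qed auto
qed

lemma partial_chain_rule:
  assumes pd: "\<And>j x. j < n \<Longrightarrow> x \<in> rpower {..<n} \<Longrightarrow> has_partial_deriv_at j f x"
    and cont: "\<And>j. j < n \<Longrightarrow> continuous_map (powertop_real {..<n}) euclideanreal (partial_deriv j f)"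
    and \<gamma>: "\<And>j. j < n \<Longrightarrow> (\<gamma> j has_real_derivative d j) (at t0)"
  shows "((\<lambda>t. f (\<lambda>j\<in>{..<n}. \<gamma> j t)) has_real_derivative
           (\<Sum>j<n. partial_deriv j f (\<lambda>j\<in>{..<n}. \<gamma> j t0) * d j)) (at t0)"
proof -
  define y where "y = (\<lambda>j\<in>{..<n}. \<gamma> j t0)"
  \<comment> \<open>\<open>z p t\<close> has its first \<open>p\<close> coordinates at time
    \<open>t\<close> and the others still at \<open>t0\<close>: it is the fixed point
    \<open>y\<close> for p = 0 and the full curve for p = n.\<close>
  define z where "z p t = (\<lambda>j\<in>{..<n}. if j < p then \<gamma> j t else \<gamma> j t0)" for p t
  have y: "y \<in> rpower {..<n}" and z: "z p t \<in> rpower {..<n}" for p t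
    unfolding y_def z_def by auto
  have \<gamma>_lim: "(\<gamma> j \<longlongrightarrow> \<gamma> j t0) (at t0)" if "j < n" for j
    using \<gamma>[OF that] by (metis DERIV_isCont isCont_def)
  \<comment> \<open>Move the coordinates along \<open>\<gamma>\<close> one at a time; each move is controlled by the mean value theorem.\<close>
  have "((\<lambda>t. f (z p t)) has_real_derivative (\<Sum>j<p. partial_deriv j f y * d j)) (at t0)"
    if "p \<le> n" for p
    using that
  proof (induction p)
    case 0
    then show ?case by (simp add: z_def)
  next
    case (Suc p)
    then have p: "p < n" by simp
    have "\<exists>s. \<bar>s - \<gamma> p t0\<bar> \<le> \<bar>\<gamma> p t - \<gamma> p t0\<bar> \<and>
        f ((z p t)(p := \<gamma> p t)) - f ((z p t)(p := \<gamma> p t0)) =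
          (\<gamma> p t - \<gamma> p t0) * partial_deriv p f ((z p t)(p := s))" for t
      by (rule partial_deriv_mean_value[OF pd z p]) (use p in auto)
    then obtain s where s: "\<And>t. \<bar>s t - \<gamma> p t0\<bar> \<le> \<bar>\<gamma> p t - \<gamma> p t0\<bar>"
      "\<And>t. f ((z p t)(p := \<gamma> p t)) - f ((z p t)(p := \<gamma> p t0)) =
          (\<gamma> p t - \<gamma> p t0) * partial_deriv p f ((z p t)(p := s t))" by metis
    have s_lim: "(s \<longlongrightarrow> \<gamma> p t0) (at t0)"
    proof -
      have "((\<lambda>t. \<gamma> p t - \<gamma> p t0) \<longlongrightarrow> 0) (at t0)"
        using \<gamma>_lim[OF p] by (simp add: LIM_zero)
      then have "((\<lambda>t. s t - \<gamma> p t0) \<longlongrightarrow> 0) (at t0)"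
        by (rule Lim_transform_bound[rotated]) (use s(1) in auto)
      then show ?thesis by (rule LIM_zero_cancel)
    qed
    have step: "(z p t)(p := \<gamma> p t) = z (Suc p) t" "(z p t)(p := \<gamma> p t0) = z p t" for t
      using p by (auto simp: z_def fun_eq_iff)
    have pd_lim: "((\<lambda>t. partial_deriv p f ((z p t)(p := s t))) \<longlongrightarrow> partial_deriv p f y) (at t0)"
    proof (rule continuous_map_tendsto[OF cont[OF p] _ y])
      show "(z p t)(p := s t) \<in> rpower {..<n}" for t by (rule rpower_upd[OF z p])
      fix i assume "i < n"
      then show "((\<lambda>t. ((z p t)(p := s t)) i) \<longlongrightarrow> y i) (at t0)"
        using s_lim \<gamma>_lim by (cases "i = p"; cases "i < p") (auto simp: z_def y_def)
    qed
    \<comment> \<open>The difference quotient is the partial derivative at the intermediate point,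
      which tends to its value at \<open>y\<close>, times the difference quotient of
      \<open>\<gamma> p\<close>; the increment vanishes at \<open>t0\<close>.\<close>
    have "((\<lambda>t. f (z (Suc p) t) - f (z p t)) has_real_derivative partial_deriv p f y * d p) (at t0)"
    proof -
      have "((\<lambda>t. partial_deriv p f ((z p t)(p := s t)) * ((\<gamma> p t - \<gamma> p t0) / (t - t0)))
          \<longlongrightarrow> partial_deriv p f y * d p) (at t0)"
        using pd_lim \<gamma>[OF p] by (intro tendsto_mult) (simp_all add: has_field_derivative_iff)
      moreover have "z (Suc p) t0 = z p t0" by (auto simp: z_def)
      moreover have "f (z (Suc p) t) - f (z p t) =
          (\<gamma> p t - \<gamma> p t0) * partial_deriv p f ((z p t)(p := s t))" for t
        using s(2)[of t] unfolding step .
      ultimately show ?thesis by (simp add: has_field_derivative_iff mult_ac)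
    qed
    from DERIV_add[OF Suc.IH this] p show ?case by simp
  qed
  from this[of n] show ?thesis by (simp add: y_def z_def cong: restrict_cong)
qed

section \<open>Closure of smooth functions under composition\<close>

lemma iterated_partial_snoc: "iterated_partial (is @ [i]) f = iterated_partial is (partial_deriv i f)"
  by (induction "is") auto

lemma smooth_continuous: "smooth n f \<Longrightarrow> continuous_map (powertop_real {..<n}) euclideanreal f"
  unfolding smooth_def by (drule spec[of _ "[]"]) simp

lemma smooth_has_partial: "\<lbrakk>smooth n f; i < n; x \<in> rpower {..<n}\<rbrakk> \<Longrightarrow> has_partial_deriv_at i f x"
  unfolding smooth_def by (drule spec[of _ "[]"]) simp

text \<open>The head of the list is differentiated last, so the iterated partials of
  \<open>partial_deriv i f\<close> are those of \<open>f\<close> for lists ending in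
  \<open>i\<close>.\<close>

lemma smooth_partial_deriv: "\<lbrakk>smooth n f; i < n\<rbrakk> \<Longrightarrow> smooth n (partial_deriv i f)"
  unfolding smooth_def iterated_partial_snoc[symmetric] by auto

text \<open>By induction on the list, each iterated partial of \<open>f\<close> agrees on
  \<open>rpower {..<n}\<close> with a member of \<open>P\<close>. Agreement there suffices for
  derivatives, because changing a coordinate below \<open>n\<close> does not leave that set.\<close>

lemma smooth_coinduct:
  assumes P: "P f"
    and cont: "\<And>u. P u \<Longrightarrow> continuous_map (powertop_real {..<n}) euclideanreal u"
    and deriv: "\<And>u i. P u \<Longrightarrow> i < n \<Longrightarrow> \<exists>u'. P u' \<and>
      (\<forall>x\<in>rpower {..<n}. ((\<lambda>t. u (x(i := t))) has_real_derivative u' x) (at (x i)))"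
  shows "smooth n f"
proof -
  have it: "\<exists>u. P u \<and> (\<forall>x\<in>rpower {..<n}. iterated_partial is f x = u x)"
    if "set is \<subseteq> {..<n}" for "is"
    using that
  proof (induction "is")
    case Nil
    then show ?case using P by auto
  next
    case (Cons i "is")
    then obtain u where u: "P u" "\<forall>x\<in>rpower {..<n}. iterated_partial is f x = u x" by auto
    have i: "i < n" using Cons.prems by simp
    obtain u' where u': "P u'"
      "\<forall>x\<in>rpower {..<n}. ((\<lambda>t. u (x(i := t))) has_real_derivative u' x) (at (x i))"
      using deriv[OF u(1) i] by blast
    have "iterated_partial (i # is) f x = u' x" if "x \<in> rpower {..<n}" for x
      using u(2) u'(2) that rpower_upd[OF that i] by (simp add: partial_deriv_def DERIV_imp_deriv)
    then show ?case using u'(1) by blast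
  qed
  show ?thesis
    unfolding smooth_def
  proof (intro allI impI conjI ballI)
    fix "is" :: "nat list" assume "set is \<subseteq> {..<n}"
    then obtain u where u: "P u" "\<forall>x\<in>rpower {..<n}. iterated_partial is f x = u x" using it by blast
    show "continuous_map (powertop_real {..<n}) euclideanreal (iterated_partial is f)"
      by (rule continuous_map_eq[OF cont[OF u(1)]]) (use u(2) in auto)
    fix i x assume i: "i < n" and x: "x \<in> rpower {..<n}"
    then show "has_partial_deriv_at i (iterated_partial is f) x"
      using deriv[OF u(1) i] u(2) rpower_upd[OF x i]
      by (auto simp: has_partial_deriv_at_def field_differentiable_def)
  qed
qed

text \<open>
  The chain rule expresses the partial derivatives of a composite by sums and products of
  composites and smooth functions; closing under these makes the class stable under all
  partial derivatives.
\<close>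

inductive chain_closure ::
  "nat \<Rightarrow> nat \<Rightarrow> (nat \<Rightarrow> (nat \<Rightarrow> real) \<Rightarrow> real) \<Rightarrow> ((nat \<Rightarrow> real) \<Rightarrow> real) \<Rightarrow> bool"
  for n k g where
  zero: "chain_closure n k g (\<lambda>x. 0)"
| smooth: "smooth k u \<Longrightarrow> chain_closure n k g u"
| comp: "smooth n f \<Longrightarrow> chain_closure n k g (\<lambda>x. f (\<lambda>i\<in>{..<n}. g i x))"
| add: "\<lbrakk>chain_closure n k g u; chain_closure n k g v\<rbrakk> \<Longrightarrow> chain_closure n k g (\<lambda>x. u x + v x)"
| mult: "\<lbrakk>chain_closure n k g u; chain_closure n k g v\<rbrakk> \<Longrightarrow> chain_closure n k g (\<lambda>x. u x * v x)"

lemma chain_closure_sum: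
  "(\<And>j. j < (p::nat) \<Longrightarrow> chain_closure n k g (u j)) \<Longrightarrow> chain_closure n k g (\<lambda>x. \<Sum>j<p. u j x)"
  by (induction p) (auto intro: chain_closure.zero chain_closure.add)

lemma smooth_has_derivative:
  assumes "smooth n f" "i < n" "x \<in> rpower {..<n}"
  shows "((\<lambda>t. f (x(i := t))) has_real_derivative partial_deriv i f x) (at (x i))"
  using smooth_has_partial[OF assms]
  by (simp add: has_partial_deriv_at_def partial_deriv_def DERIV_deriv_iff_field_differentiable)

lemma chain_closure_continuous:
  assumes "chain_closure n k g u" and g: "\<And>i. i < n \<Longrightarrow> smooth k (g i)"
  shows "continuous_map (powertop_real {..<k}) euclideanreal u"
  using assms(1)
proof induction
  case (comp f)
  have "continuous_map (powertop_real {..<k}) (powertop_real {..<n}) (\<lambda>x. \<lambda>i\<in>{..<n}. g i x)"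
    unfolding continuous_map_componentwise
    using smooth_continuous[OF g] by auto
  from continuous_map_compose[OF this smooth_continuous[OF comp]] show ?case by (simp add: o_def)
qed (auto intro: smooth_continuous continuous_map_add continuous_map_real_mult)

lemma chain_closure_deriv:
  assumes "chain_closure n k g u" and g: "\<And>i. i < n \<Longrightarrow> smooth k (g i)" and i: "i < k"
  shows "\<exists>u'. chain_closure n k g u' \<and>
    (\<forall>x\<in>rpower {..<k}. ((\<lambda>t. u (x(i := t))) has_real_derivative u' x) (at (x i)))"
  using assms(1)
proof induction
  case zero
  then show ?case by (intro exI[of _ "\<lambda>x. 0"]) (auto intro: chain_closure.zero)
next
  case (smooth u)
  show ?case
    using chain_closure.smooth[OF smooth_partial_deriv[OF smooth i]] smooth_has_derivative[OF smooth i]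
    by blast
next
  case (comp f)
  let ?u' = "\<lambda>x. \<Sum>j<n. partial_deriv j f (\<lambda>i\<in>{..<n}. g i x) * partial_deriv i (g j) x"
  have "chain_closure n k g ?u'"
    by (intro chain_closure_sum chain_closure.mult chain_closure.comp chain_closure.smooth
        smooth_partial_deriv comp g i)
  moreover have "((\<lambda>t. f (\<lambda>j\<in>{..<n}. g j (x(i := t)))) has_real_derivative ?u' x) (at (x i))"
    if "x \<in> rpower {..<k}" for x
    \<comment> \<open>The curves are \<open>\<lambda>t. g j (x(i := t))\<close>, differentiated at
      \<open>x i\<close>, where \<open>x(i := x i)\<close> is \<open>x\<close> itself.\<close>
    using partial_chain_rule[OF smooth_has_partial[OF comp]
        smooth_continuous[OF smooth_partial_deriv[OF comp]]
        smooth_has_derivative[OF g i that], of "\<lambda>j. j"]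
    by simp
  ultimately show ?case by blast
next
  case (add u v)
  then obtain u' v' where d: "chain_closure n k g u'" "chain_closure n k g v'"
    "\<forall>x\<in>rpower {..<k}. ((\<lambda>t. u (x(i := t))) has_real_derivative u' x) (at (x i))"
    "\<forall>x\<in>rpower {..<k}. ((\<lambda>t. v (x(i := t))) has_real_derivative v' x) (at (x i))" by blast
  have "((\<lambda>t. u (x(i := t)) + v (x(i := t))) has_real_derivative u' x + v' x) (at (x i))"
    if "x \<in> rpower {..<k}" for x
    by (rule DERIV_add[OF bspec[OF d(3) that] bspec[OF d(4) that]])
  with chain_closure.add[OF d(1,2)] show ?case by blast
next
  case (mult u v)
  then obtain u' v' where d: "chain_closure n k g u'" "chain_closure n k g v'"
    "\<forall>x\<in>rpower {..<k}. ((\<lambda>t. u (x(i := t))) has_real_derivative u' x) (at (x i))"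
    "\<forall>x\<in>rpower {..<k}. ((\<lambda>t. v (x(i := t))) has_real_derivative v' x) (at (x i))" by blast
  have "((\<lambda>t. u (x(i := t)) * v (x(i := t))) has_real_derivative u x * v' x + u' x * v x) (at (x i))"
    if "x \<in> rpower {..<k}" for x
    using DERIV_mult'[OF bspec[OF d(3) that] bspec[OF d(4) that]] by simp
  moreover have "chain_closure n k g (\<lambda>x. u x * v' x + u' x * v x)"
    by (intro chain_closure.add chain_closure.mult d(1,2) mult.hyps)
  ultimately show ?case by blast
qed

lemma smooth_compose:
  assumes "smooth n f" "\<And>i. i < n \<Longrightarrow> smooth k (g i)"
  shows "smooth k (\<lambda>x. f (\<lambda>i\<in>{..<n}. g i x))"
  by (rule smooth_coinduct[of "chain_closure n k g"])
    (auto intro: chain_closure.comp assms chain_closure_continuous chain_closure_deriv)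

text \<open>Composites arise as functions on all of \<open>nat \<Rightarrow> real\<close>, whereas
  members of \<open>Cinf\<close> are cut down to tuples. The passage is a coinduction whose
  invariant is agreement on tuples with some smooth function.\<close>

lemma smooth_cong:
  assumes "smooth n f" "\<And>x. x \<in> rpower {..<n} \<Longrightarrow> h x = f x"
  shows "smooth n h"
proof (rule smooth_coinduct[of "\<lambda>u. \<exists>v. smooth n v \<and> (\<forall>x\<in>rpower {..<n}. u x = v x)"])
  show "\<exists>v. smooth n v \<and> (\<forall>x\<in>rpower {..<n}. h x = v x)" using assms by blast
next
  fix u assume "\<exists>v. smooth n v \<and> (\<forall>x\<in>rpower {..<n}. u x = v x)"
  then obtain v where v: "smooth n v" "\<forall>x\<in>rpower {..<n}. u x = v x" by blast
  show "continuous_map (powertop_real {..<n}) euclideanreal u"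
    by (rule continuous_map_eq[OF smooth_continuous[OF v(1)]]) (use v(2) in auto)
  fix i assume i: "i < n"
  show "\<exists>u'. (\<exists>v. smooth n v \<and> (\<forall>x\<in>rpower {..<n}. u' x = v x)) \<and>
      (\<forall>x\<in>rpower {..<n}. ((\<lambda>t. u (x(i := t))) has_real_derivative u' x) (at (x i)))"
    using v smooth_partial_deriv[OF v(1) i] smooth_has_derivative[OF v(1) i] rpower_upd[OF _ i]
    by (intro exI[of _ "partial_deriv i v"]) auto
qed

text \<open>The composition axiom speaks of composites that already belong to \<open>Cinf k\<close>;
  the chain rule supplies this membership, so that \<open>cinf_ring_compose\<close> can do without
  it.\<close>

lemma compose_tuple_Cinf:
  assumes "f \<in> Cinf n" "g \<in> tuples n (Cinf k)"
  shows "compose_tuple n k f g \<in> Cinf k"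
proof -
  have "smooth k (\<lambda>x. f (\<lambda>i\<in>{..<n}. g i x))"
    using assms by (intro smooth_compose) (auto simp: Cinf_def)
  then have "smooth k (compose_tuple n k f g)"
    by (rule smooth_cong) (simp add: compose_tuple_def)
  then show ?thesis by (auto simp: Cinf_def compose_tuple_def)
qed

section \<open>Smooth ring axioms, substitutions and enumerations\<close>

lemma cinf_ring_proj:
  "\<lbrakk>cinf_ring S; k < n; a \<in> tuples n (carr S)\<rbrakk> \<Longrightarrow> oper S n (proj n k) a = a k"
  unfolding cinf_ring_def by (elim conjE) simp

lemma cinf_ring_compose:
  assumes "cinf_ring S" "f \<in> Cinf n" "g \<in> tuples n (Cinf k)" "a \<in> tuples k (carr S)"
  shows "oper S k (compose_tuple n k f g) a = oper S n f (\<lambda>i\<in>{..<n}. oper S k (g i) a)"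
  using assms compose_tuple_Cinf[OF assms(2,3)] unfolding cinf_ring_def by (elim conjE) simp

text \<open>Unlike the enumeration in \<open>hat\<close>, \<open>x\<close> may repeat or omit
  elements of \<open>X\<close>, and \<open>n\<close> need not be its size. This form survives an
  enlargement of \<open>X\<close>.\<close>

definition subst_vars ::
  "'e set \<Rightarrow> nat \<Rightarrow> (nat \<Rightarrow> 'e) \<Rightarrow> ((nat \<Rightarrow> real) \<Rightarrow> real) \<Rightarrow> ('e \<Rightarrow> real) \<Rightarrow> real" where
  "subst_vars X n x g = (\<lambda>t\<in>rpower X. g (\<lambda>i\<in>{..<n}. t (x i)))"

lemma hat_eq_subst_vars: "hat X x g = subst_vars X (card X) x g"
  by (simp add: hat_def subst_vars_def)

text \<open>\<open>carr (Cinf_fin X)\<close> admits all enumerations of \<open>X\<close>; fixing one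
  gives each element a normal form \<open>hat X (enum X) g\<close>.\<close>

definition enum :: "'e set \<Rightarrow> nat \<Rightarrow> 'e" where
  "enum X = (SOME e. bij_betw e {..<card X} X)"

definition idx :: "'e set \<Rightarrow> 'e \<Rightarrow> nat" where
  "idx X = inv_into {..<card X} (enum X)"

lemma bij_enum: "finite X \<Longrightarrow> bij_betw (enum X) {..<card X} X"
  using someI_ex[OF ex_bij_betw_nat_finite[of X]] by (simp add: enum_def atLeast0LessThan)

lemma enum_mem: "finite X \<Longrightarrow> i < card X \<Longrightarrow> enum X i \<in> X"
  using bij_enum[of X] by (auto simp: bij_betw_def)

lemma idx_less: "finite X \<Longrightarrow> x \<in> X \<Longrightarrow> idx X x < card X"
  using bij_enum[of X] inv_into_into[of x "enum X" "{..<card X}"]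
  by (auto simp: idx_def bij_betw_def)

lemma enum_idx: "finite X \<Longrightarrow> x \<in> X \<Longrightarrow> enum X (idx X x) = x"
  using bij_enum[of X] by (auto simp: idx_def bij_betw_def f_inv_into_f)

lemma idx_enum: "finite X \<Longrightarrow> i < card X \<Longrightarrow> idx X (enum X i) = i"
  using bij_enum[of X] by (auto simp: idx_def bij_betw_def)

lemma reindex_tuple:
  assumes "finite X" "x ` {..<n} \<subseteq> X"
  shows "(\<lambda>i\<in>{..<n}. proj (card X) (idx X (x i))) \<in> tuples n (Cinf (card X))"
  using assms by (auto intro!: proj_Cinf idx_less)

text \<open>The variable \<open>x i\<close> is the coordinate \<open>idx X (x i)\<close> of the
  fixed enumeration, so every substitution is a composition with a tuple of projections.\<close>

lemma subst_vars_eq_hat: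
  assumes X: "finite X" and x: "x ` {..<n} \<subseteq> X"
  shows "subst_vars X n x g = hat X (enum X)
    (compose_tuple n (card X) g (\<lambda>i\<in>{..<n}. proj (card X) (idx X (x i))))"
  unfolding subst_vars_def hat_def
proof (rule restrict_ext)
  fix t :: "'a \<Rightarrow> real" assume "t \<in> rpower X"
  have "(\<lambda>i\<in>{..<n}. t (x i)) = (\<lambda>i\<in>{..<n}. (\<lambda>i\<in>{..<n}. proj (card X) (idx X (x i))) i
      (\<lambda>i\<in>{..<card X}. t (enum X i)))"
    using x X by (intro restrict_ext) (auto simp: proj_def idx_less enum_idx image_subset_iff)
  then show "g (\<lambda>i\<in>{..<n}. t (x i)) = compose_tuple n (card X) g
      (\<lambda>i\<in>{..<n}. proj (card X) (idx X (x i))) (\<lambda>i\<in>{..<card X}. t (enum X i))"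
    by (simp add: compose_tuple_def)
qed

lemma subst_vars_carr:
  assumes "finite X" "x ` {..<n} \<subseteq> X" "g \<in> Cinf n"
  shows "subst_vars X n x g \<in> carr (Cinf_fin X)"
  unfolding subst_vars_eq_hat[OF assms(1,2)]
  using bij_enum[OF assms(1)] compose_tuple_Cinf[OF assms(3) reindex_tuple[OF assms(1,2)]]
  by (auto simp: Cinf_fin_def)

text \<open>Another enumeration is one more substitution of variables, so
  \<open>subst_vars_eq_hat\<close> brings it to normal form.\<close>

lemma carr_Cinf_finE:
  assumes X: "finite X" and u: "u \<in> carr (Cinf_fin X)"
  obtains g where "g \<in> Cinf (card X)" "u = hat X (enum X) g"
proof -
  obtain x g where x: "bij_betw x {..<card X} X" "g \<in> Cinf (card X)" "u = hat X x g"
    using u by (auto simp: Cinf_fin_def)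
  have x': "x ` {..<card X} \<subseteq> X" using x(1) by (simp add: bij_betw_def)
  show ?thesis
    using that compose_tuple_Cinf[OF x(2) reindex_tuple[OF X x']] subst_vars_eq_hat[OF X x', of g] x(3)
    unfolding hat_eq_subst_vars by metis
qed

section \<open>The smooth ring of a finite set of variables\<close>

lemma carr_Cinf_fin_extensional: "u \<in> carr (Cinf_fin X) \<Longrightarrow> u \<in> extensional (rpower X)"
  by (auto simp: Cinf_fin_def hat_def)

lemma oper_Cinf_fin: "oper (Cinf_fin X) m f u = (\<lambda>t\<in>rpower X. f (\<lambda>i\<in>{..<m}. u i t))"
  by (simp add: Cinf_fin_def)

lemma oper_Cinf_fin_hat:
  assumes X: "finite X" and g: "g \<in> tuples m (Cinf (card X))"
    and u: "\<forall>i<m. u i = hat X (enum X) (g i)"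
  shows "oper (Cinf_fin X) m f u = hat X (enum X) (compose_tuple m (card X) f g)"
proof -
  show ?thesis
    unfolding oper_Cinf_fin hat_def
  proof (rule restrict_ext)
    fix t :: "'a \<Rightarrow> real" assume t: "t \<in> rpower X"
    have "(\<lambda>i\<in>{..<m}. u i t) = (\<lambda>i\<in>{..<m}. g i (\<lambda>i\<in>{..<card X}. t (enum X i)))"
      using t u by (intro restrict_ext) (simp add: hat_def)
    then show "f (\<lambda>i\<in>{..<m}. u i t) = compose_tuple m (card X) f g (\<lambda>i\<in>{..<card X}. t (enum X i))"
      by (simp add: compose_tuple_def)
  qed
qed

lemma common_enum:
  assumes X: "finite X" and a: "a \<in> tuples m (carr (Cinf_fin X))"
  obtains g where "g \<in> tuples m (Cinf (card X))" "\<forall>i<m. a i = hat X (enum X) (g i)"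
proof -
  have "\<forall>i\<in>{..<m}. \<exists>g. g \<in> Cinf (card X) \<and> a i = hat X (enum X) g"
  proof
    fix i assume "i \<in> {..<m}"
    then have "a i \<in> carr (Cinf_fin X)" using a by auto
    then show "\<exists>g. g \<in> Cinf (card X) \<and> a i = hat X (enum X) g" using carr_Cinf_finE[OF X] by metis
  qed
  then obtain g where "\<forall>i\<in>{..<m}. g i \<in> Cinf (card X) \<and> a i = hat X (enum X) (g i)" by metis
  then show ?thesis by (intro that[of "restrict g {..<m}"]) auto
qed

lemma hat_enum_carr: "\<lbrakk>finite X; g \<in> Cinf (card X)\<rbrakk> \<Longrightarrow> hat X (enum X) g \<in> carr (Cinf_fin X)"
  using bij_enum[of X] by (auto simp: Cinf_fin_def)

lemma cinf_ring_Cinf_fin: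
  assumes X: "finite X"
  shows "cinf_ring (Cinf_fin X)"
  unfolding cinf_ring_def cinf_structure_def
proof (intro conjI allI ballI impI)
  fix n f assume f: "f \<in> Cinf n"
  show "oper (Cinf_fin X) n f \<in> tuples n (carr (Cinf_fin X)) \<rightarrow> carr (Cinf_fin X)"
  proof
    fix a assume "a \<in> tuples n (carr (Cinf_fin X))"
    then obtain g where g: "g \<in> tuples n (Cinf (card X))" "\<forall>i<n. a i = hat X (enum X) (g i)"
      using common_enum[OF X] by metis
    show "oper (Cinf_fin X) n f a \<in> carr (Cinf_fin X)"
      unfolding oper_Cinf_fin_hat[OF X g] by (rule hat_enum_carr[OF X compose_tuple_Cinf[OF f g(1)]])
  qed
next
  fix n k a assume k: "k < n" and a: "a \<in> tuples n (carr (Cinf_fin X))"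
  \<comment> \<open>The operation returns a function restricted to \<open>rpower X\<close>;
    recovering \<open>a k\<close> itself takes its extensionality.\<close>
  have "a k \<in> carr (Cinf_fin X)" using a k by auto
  then have "a k \<in> extensional (rpower X)" by (rule carr_Cinf_fin_extensional)
  then have "(\<lambda>t\<in>rpower X. a k t) = a k" by (rule extensional_restrict)
  then show "oper (Cinf_fin X) n (proj n k) a = a k"
    using k by (simp add: oper_Cinf_fin proj_def)
next
  fix n k f g h a
  assume "h = compose_tuple n k f g"
  then show "oper (Cinf_fin X) k h a = oper (Cinf_fin X) n f (\<lambda>i\<in>{..<n}. oper (Cinf_fin X) k (g i) a)"
    by (auto simp: oper_Cinf_fin compose_tuple_def intro!: restrict_ext arg_cong[of _ _ f])
qed

section \<open>Transition maps and the directed system\<close>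

lemma transition_subst_vars:
  assumes "X \<subseteq> Y" "x ` {..<n} \<subseteq> X"
  shows "transition X Y (subst_vars X n x g) = subst_vars Y n x g"
  unfolding transition_def subst_vars_def
proof (rule restrict_ext)
  fix t :: "'a \<Rightarrow> real"
  \<comment> \<open>Only coordinates in \<open>X\<close> are read, so the same \<open>g\<close> and
    \<open>x\<close> present the element over \<open>X\<close> and its image over
    \<open>Y\<close>.\<close>
  have "(\<lambda>i\<in>{..<n}. restrict t X (x i)) = (\<lambda>i\<in>{..<n}. t (x i))"
    using assms by (intro restrict_ext) auto
  then show "(\<lambda>t\<in>rpower X. g (\<lambda>i\<in>{..<n}. t (x i))) (restrict t X) = g (\<lambda>i\<in>{..<n}. t (x i))"
    by simp
qed

lemma transition_carr:
  assumes "finite Y" "X \<subseteq> Y" "u \<in> carr (Cinf_fin X)"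
  shows "transition X Y u \<in> carr (Cinf_fin Y)"
proof -
  have X: "finite X" using assms finite_subset by blast
  obtain g where g: "g \<in> Cinf (card X)" "u = hat X (enum X) g" using carr_Cinf_finE[OF X assms(3)] .
  have sub: "enum X ` {..<card X} \<subseteq> X" using enum_mem[OF X] by auto
  show ?thesis
    unfolding g(2) hat_eq_subst_vars transition_subst_vars[OF assms(2) sub]
    by (rule subst_vars_carr) (use assms sub g in auto)
qed

lemma transition_hom:
  assumes "finite Y" "X \<subseteq> Y"
  shows "restrict (transition X Y) (carr (Cinf_fin X)) \<in> cinf_hom (Cinf_fin X) (Cinf_fin Y)"
  unfolding cinf_hom_def
proof (intro CollectI conjI allI ballI)
  show "restrict (transition X Y) (carr (Cinf_fin X)) \<in> carr (Cinf_fin X) \<rightarrow>\<^sub>E carr (Cinf_fin Y)"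
    using transition_carr[OF assms] by auto
  fix m f u assume f: "f \<in> Cinf m" and u: "u \<in> tuples m (carr (Cinf_fin X))"
  have X: "finite X" using assms finite_subset by blast
  have ui: "u i \<in> carr (Cinf_fin X)" if "i < m" for i using u that by auto
  have "transition X Y (oper (Cinf_fin X) m f u) =
      oper (Cinf_fin Y) m f (\<lambda>i\<in>{..<m}. restrict (transition X Y) (carr (Cinf_fin X)) (u i))"
    unfolding oper_Cinf_fin transition_def
  proof (rule restrict_ext)
    fix t :: "'a \<Rightarrow> real" assume t: "t \<in> rpower Y"
    have "(\<lambda>i\<in>{..<m}. u i (restrict t X)) =
        (\<lambda>i\<in>{..<m}. (\<lambda>i\<in>{..<m}. (\<lambda>u\<in>carr (Cinf_fin X). \<lambda>t\<in>rpower Y. u (restrict t X)) (u i)) i t)"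
      using t ui by (intro restrict_ext) simp
    then show "(\<lambda>t\<in>rpower X. f (\<lambda>i\<in>{..<m}. u i t)) (restrict t X) =
        f (\<lambda>i\<in>{..<m}. (\<lambda>i\<in>{..<m}. (\<lambda>u\<in>carr (Cinf_fin X). \<lambda>t\<in>rpower Y. u (restrict t X)) (u i)) i t)"
      by simp
  qed
  then show "restrict (transition X Y) (carr (Cinf_fin X)) (oper (Cinf_fin X) m f u) =
      oper (Cinf_fin Y) m f (\<lambda>i\<in>{..<m}. restrict (transition X Y) (carr (Cinf_fin X)) (u i))"
    using cinf_ring_oper[OF cinf_ring_Cinf_fin[OF X] f u] by simp
qed

text \<open>
  Homomorphisms are extensional, so the transition maps have to be cut down to the carriers
  before the theory of directed systems applies; this does not affect the colimit.
\<close>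

definition rtransition ::
  "'e set \<Rightarrow> 'e set \<Rightarrow> (('e \<Rightarrow> real) \<Rightarrow> real) \<Rightarrow> ('e \<Rightarrow> real) \<Rightarrow> real" where
  "rtransition X Y = restrict (transition X Y) (carr (Cinf_fin X))"

lemma dircolim_rel_rtransition:
  "dircolim_rel I le Cinf_fin rtransition = dircolim_rel I le Cinf_fin transition"
  by (auto simp: dircolim_rel_def rtransition_def)

lemma dircolim_in_rtransition:
  "dircolim_in I le Cinf_fin rtransition = dircolim_in I le Cinf_fin transition"
  by (simp add: dircolim_in_def[abs_def] dircolim_rel_rtransition)

lemma Cinf_free_rtransition:
  "Cinf_free E = dircolim {X. finite X \<and> X \<subseteq> E} (\<subseteq>) Cinf_fin rtransition"
  by (simp add: Cinf_free_def dircolim_def dircolim_rel_rtransition dircolim_in_rtransition)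

lemma ell_rtransition:
  "ell E = dircolim_in {X. finite X \<and> X \<subseteq> E} (\<subseteq>) Cinf_fin rtransition"
  by (simp add: ell_def dircolim_in_rtransition)

lemma directed_system_Cinf_fin:
  "directed_system {X. finite X \<and> X \<subseteq> E} (\<subseteq>) Cinf_fin rtransition"
proof (unfold_locales; (elim CollectE conjE)?)
  show "{X. finite X \<and> X \<subseteq> E} \<noteq> {}" by blast
next
  fix X Y assume "finite X" "finite Y" "X \<subseteq> E" "Y \<subseteq> E"
  then show "\<exists>Z\<in>{X. finite X \<and> X \<subseteq> E}. X \<subseteq> Z \<and> Y \<subseteq> Z"
    by (intro bexI[of _ "X \<union> Y"]) auto
next
  fix X Y :: "'a set" assume "finite Y" "X \<subseteq> Y"
  then show "rtransition X Y \<in> cinf_hom (Cinf_fin X) (Cinf_fin Y)"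
    unfolding rtransition_def by (rule transition_hom)
next
  fix X and u :: "('a \<Rightarrow> real) \<Rightarrow> real" assume u: "u \<in> carr (Cinf_fin X)"
  then have "(\<lambda>t\<in>rpower X. u t) = u" by (intro extensional_restrict carr_Cinf_fin_extensional)
  moreover have "(\<lambda>t\<in>rpower X. u (restrict t X)) = (\<lambda>t\<in>rpower X. u t)"
    by (intro restrict_ext) simp
  ultimately show "rtransition X X u = u" using u by (simp add: rtransition_def transition_def)
next
  fix X Y Z and u :: "('a \<Rightarrow> real) \<Rightarrow> real"
  assume "finite Y" and sub: "X \<subseteq> Y" "Y \<subseteq> Z" and u: "u \<in> carr (Cinf_fin X)"
  then have "transition X Y u \<in> carr (Cinf_fin Y)" by (intro transition_carr)
  then show "rtransition Y Z (rtransition X Y u) = rtransition X Z u"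
    using u sub by (auto simp: rtransition_def transition_def Int_absorb1 intro!: restrict_ext)
qed (auto intro: cinf_ring_Cinf_fin)

section \<open>The coordinate functions as generators\<close>

lemma ev_eq_subst_vars:
  assumes "x \<in> X"
  shows "ev X x = subst_vars X 1 (\<lambda>i. x) (proj 1 0)"
  \<comment> \<open>\<open>proj 1 0\<close> is the identity in one variable; in this form the lemmas
    on substitutions apply to the generators.\<close>
  using assms by (auto simp: ev_def subst_vars_def proj_def intro!: restrict_ext)

lemma ev_carr: "\<lbrakk>finite X; x \<in> X\<rbrakk> \<Longrightarrow> ev X x \<in> carr (Cinf_fin X)"
  unfolding ev_eq_subst_vars by (intro subst_vars_carr) (auto simp: proj_Cinf)

text \<open>Uniqueness rests on this: the evaluations generate \<open>Cinf_fin X\<close> under its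
  operations, so a homomorphism is determined by its values on them.\<close>

lemma hat_eq_oper_ev:
  assumes X: "finite X"
  shows "hat X (enum X) g = oper (Cinf_fin X) (card X) g (\<lambda>i\<in>{..<card X}. ev X (enum X i))"
  by (auto simp: hat_def oper_Cinf_fin ev_def enum_mem[OF X] intro!: restrict_ext arg_cong[of _ _ g])

text \<open>The transition from \<open>{x}\<close> to a larger stage carries evaluation to
  evaluation, so all stages containing \<open>x\<close> give one class. As \<open>{x}\<close> is
  itself a stage, the description defining \<open>jmath\<close> has exactly one solution.\<close>

lemma jmath_eq:
  assumes "finite X" "X \<subseteq> E" "x \<in> X"
  shows "jmath E x = ell E X (ev X x)"
proof -
  interpret directed_system "{X. finite X \<and> X \<subseteq> E}" "(\<subseteq>)" Cinf_fin rtransition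
    by (rule directed_system_Cinf_fin)
  have ell_ev: "ell E Y (ev Y x) = ell E {x} (ev {x} x)" if "finite Y" "Y \<subseteq> E" "x \<in> Y" for Y
  proof -
    have "rtransition {x} Y (ev {x} x) = transition {x} Y (subst_vars {x} 1 (\<lambda>i. x) (proj 1 0))"
      unfolding ev_eq_subst_vars[OF singletonI, symmetric] by (simp add: rtransition_def ev_carr)
    also have "\<dots> = ev Y x"
      unfolding ev_eq_subst_vars[OF that(3)] by (rule transition_subst_vars) (use that in auto)
    finally have "rtransition {x} Y (ev {x} x) = ev Y x" .
    then show ?thesis
      using lin_trans[of "{x}" Y "ev {x} x"] that subsetD[OF that(2,3)]
      by (simp add: ell_rtransition ev_carr)
  qed
  have "(THE c. \<forall>Y. finite Y \<and> Y \<subseteq> E \<and> x \<in> Y \<longrightarrow> c = ell E Y (ev Y x)) = ell E {x} (ev {x} x)"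
    using assms ell_ev by (intro the_equality) auto
  then show ?thesis using assms ell_ev[OF assms] by (auto simp: jmath_def)
qed

section \<open>Evaluation at elements of a smooth ring\<close>

definition eval_at :: "'a cinf_struct \<Rightarrow> ('e \<Rightarrow> 'a) \<Rightarrow> 'e set \<Rightarrow> (('e \<Rightarrow> real) \<Rightarrow> real) \<Rightarrow> 'a" where
  "eval_at A f X = (\<lambda>u\<in>carr (Cinf_fin X).
     oper A (card X) (\<lambda>y\<in>rpower {..<card X}. u (\<lambda>x\<in>X. y (idx X x))) (\<lambda>i\<in>{..<card X}. f (enum X i)))"

text \<open>The point \<open>\<lambda>x\<in>X. y (idx X x)\<close> has coordinates \<open>y\<close>
  in the fixed enumeration, so the inner function of \<open>eval_at\<close> recovers the
  representative \<open>g\<close> without choosing one.\<close>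

lemma eval_at_hat:
  assumes X: "finite X" and g: "g \<in> Cinf (card X)"
  shows "eval_at A f X (hat X (enum X) g) = oper A (card X) g (\<lambda>i\<in>{..<card X}. f (enum X i))"
proof -
  have "(\<lambda>y\<in>rpower {..<card X}. hat X (enum X) g (\<lambda>x\<in>X. y (idx X x))) = (\<lambda>y\<in>rpower {..<card X}. g y)"
  proof (rule restrict_ext)
    fix y :: "nat \<Rightarrow> real" assume y: "y \<in> rpower {..<card X}"
    have "(\<lambda>i\<in>{..<card X}. (\<lambda>x\<in>X. y (idx X x)) (enum X i)) = (\<lambda>i\<in>{..<card X}. y i)"
      using X by (intro restrict_ext) (simp add: enum_mem idx_enum)
    also have "\<dots> = y" using y by (rule PiE_restrict)
    finally show "hat X (enum X) g (\<lambda>x\<in>X. y (idx X x)) = g y" by (simp add: hat_def)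
  qed
  also have "\<dots> = g" using g by (auto simp: Cinf_def PiE_def intro: extensional_restrict)
  finally show ?thesis using hat_enum_carr[OF X g] by (simp add: eval_at_def)
qed

text \<open>The composition axiom of \<open>A\<close> turns the reindexing by projections into
  operations of \<open>A\<close>, and the projection axiom evaluates these to the
  \<open>f (x i)\<close>. Hence the value does not depend on the presentation.\<close>

lemma eval_at_subst_vars:
  assumes A: "cinf_ring A" and f: "f \<in> X \<rightarrow> carr A" and X: "finite X"
    and x: "x ` {..<n} \<subseteq> X" and g: "g \<in> Cinf n"
  shows "eval_at A f X (subst_vars X n x g) = oper A n g (\<lambda>i\<in>{..<n}. f (x i))"
proof -
  let ?a = "\<lambda>i\<in>{..<card X}. f (enum X i)"
  have a: "?a \<in> tuples (card X) (carr A)" using f enum_mem[OF X] by auto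
  note r = reindex_tuple[OF X x]
  have "eval_at A f X (subst_vars X n x g) = oper A n g
      (\<lambda>i\<in>{..<n}. oper A (card X) ((\<lambda>i\<in>{..<n}. proj (card X) (idx X (x i))) i) ?a)"
    unfolding subst_vars_eq_hat[OF X x] eval_at_hat[OF X compose_tuple_Cinf[OF g r]]
    by (rule cinf_ring_compose[OF A g r a])
  also have "(\<lambda>i\<in>{..<n}. oper A (card X) ((\<lambda>i\<in>{..<n}. proj (card X) (idx X (x i))) i) ?a) =
      (\<lambda>i\<in>{..<n}. f (x i))"
    using x by (intro restrict_ext)
      (simp add: cinf_ring_proj[OF A _ a] idx_less[OF X] enum_idx[OF X] image_subset_iff)
  finally show ?thesis .
qed

text \<open>On normal forms an operation composes representatives, which the composition axiom of
  \<open>A\<close> matches on the other side.\<close>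

lemma eval_at_hom:
  assumes A: "cinf_ring A" and f: "f \<in> X \<rightarrow> carr A" and X: "finite X"
  shows "eval_at A f X \<in> cinf_hom (Cinf_fin X) A"
  unfolding cinf_hom_def
proof (intro CollectI conjI allI ballI)
  let ?a = "\<lambda>i\<in>{..<card X}. f (enum X i)"
  have a: "?a \<in> tuples (card X) (carr A)" using f enum_mem[OF X] by auto
  show "eval_at A f X \<in> carr (Cinf_fin X) \<rightarrow>\<^sub>E carr A"
  proof (rule PiE_I)
    fix u assume "u \<in> carr (Cinf_fin X)"
    then obtain g where "g \<in> Cinf (card X)" "u = hat X (enum X) g" by (rule carr_Cinf_finE[OF X])
    then show "eval_at A f X u \<in> carr A"
      by (simp add: eval_at_hat[OF X] cinf_ring_oper[OF A _ a])
  qed (simp add: eval_at_def)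
  fix m h u assume h: "h \<in> Cinf m" and "u \<in> tuples m (carr (Cinf_fin X))"
  then obtain g where g: "g \<in> tuples m (Cinf (card X))" "\<forall>i<m. u i = hat X (enum X) (g i)"
    using common_enum[OF X] by metis
  have gi: "g i \<in> Cinf (card X)" if "i < m" for i using g(1) that by auto
  have "eval_at A f X (oper (Cinf_fin X) m h u) = oper A m h (\<lambda>i\<in>{..<m}. oper A (card X) (g i) ?a)"
    unfolding oper_Cinf_fin_hat[OF X g] eval_at_hat[OF X compose_tuple_Cinf[OF h g(1)]]
    by (rule cinf_ring_compose[OF A h g(1) a])
  also have "(\<lambda>i\<in>{..<m}. oper A (card X) (g i) ?a) = (\<lambda>i\<in>{..<m}. eval_at A f X (u i))"
    using g(2) gi by (intro restrict_ext) (simp add: eval_at_hat[OF X])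
  finally show "eval_at A f X (oper (Cinf_fin X) m h u) = oper A m h (\<lambda>i\<in>{..<m}. eval_at A f X (u i))" .
qed

lemma eval_at_ev:
  assumes A: "cinf_ring A" and f: "f \<in> X \<rightarrow> carr A" and X: "finite X" and x: "x \<in> X"
  shows "eval_at A f X (ev X x) = f x"
proof -
  have "(\<lambda>i\<in>{..<1}. f x) \<in> tuples 1 (carr A)" using f x by auto
  then show ?thesis
    unfolding ev_eq_subst_vars[OF x] using x
    by (subst eval_at_subst_vars[OF A f X]) (auto simp: proj_Cinf cinf_ring_proj[OF A])
qed

text \<open>The cocone condition for the colimit: passing to \<open>Y\<close> keeps \<open>g\<close>
  and its variables, and these determine the value.\<close>

lemma eval_at_rtransition:
  assumes A: "cinf_ring A" and f: "f \<in> Y \<rightarrow> carr A" and Y: "finite Y" and XY: "X \<subseteq> Y"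
    and u: "u \<in> carr (Cinf_fin X)"
  shows "eval_at A f Y (rtransition X Y u) = eval_at A f X u"
proof -
  have X: "finite X" using XY Y by (rule finite_subset)
  obtain g where g: "g \<in> Cinf (card X)" "u = hat X (enum X) g" using carr_Cinf_finE[OF X u] .
  have sub: "enum X ` {..<card X} \<subseteq> X" using enum_mem[OF X] by auto
  have "rtransition X Y u = subst_vars Y (card X) (enum X) g"
    using u unfolding g(2) by (simp add: rtransition_def hat_eq_subst_vars transition_subst_vars[OF XY sub])
  then show ?thesis
    using sub XY by (simp add: eval_at_subst_vars[OF A f Y] g eval_at_hat[OF X])
qed

section \<open>The universal property\<close>

lemma cinf_hom_oper:
  "\<lbrakk>\<phi> \<in> cinf_hom S T; f \<in> Cinf n; a \<in> tuples n (carr S)\<rbrakk>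
    \<Longrightarrow> \<phi> (oper S n f a) = oper T n f (\<lambda>i\<in>{..<n}. \<phi> (a i))"
  unfolding cinf_hom_def by blast

theorem proposition10:
  fixes E :: "'e set"
  shows "cinf_ring (Cinf_free E) \<and>
         jmath E \<in> E \<rightarrow> carr (Cinf_free E) \<and>
         (\<forall>(A :: 'a cinf_struct) f. cinf_ring A \<and> f \<in> E \<rightarrow> carr A \<longrightarrow>
            (\<exists>!\<phi>. \<phi> \<in> cinf_hom (Cinf_free E) A \<and> (\<forall>x\<in>E. \<phi> (jmath E x) = f x)))"
proof -
  interpret directed_system "{X. finite X \<and> X \<subseteq> E}" "(\<subseteq>)" Cinf_fin rtransition
    by (rule directed_system_Cinf_fin)
  note free = Cinf_free_rtransition[of E, symmetric] ell_rtransition[of E, symmetric]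
  have jm: "jmath E x = ell E {x} (ev {x} x)" if "x \<in> E" for x
    using that by (intro jmath_eq) auto
  have "\<exists>!\<phi>. \<phi> \<in> cinf_hom (Cinf_free E) A \<and> (\<forall>x\<in>E. \<phi> (jmath E x) = f x)"
    if A: "cinf_ring A" and f: "f \<in> E \<rightarrow> carr A" for A :: "'a cinf_struct" and f
  proof -
    have fX: "f \<in> X \<rightarrow> carr A" if "X \<subseteq> E" for X using f that by auto
    have "\<exists>!\<phi>. \<phi> \<in> cinf_hom (Cinf_free E) A \<and>
        (\<forall>X\<in>{X. finite X \<and> X \<subseteq> E}. \<forall>u\<in>carr (Cinf_fin X). \<phi> (ell E X u) = eval_at A f X u)"
      using dircolim_is_colimit(4)[OF A, of "eval_at A f", unfolded free]
      by (auto simp: eval_at_hom[OF A fX] eval_at_rtransition[OF A fX])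
    \<comment> \<open>The colimit gives a unique homomorphism extending the cocone of evaluations.
      For homomorphisms, extending it amounts to taking the values of \<open>f\<close> on the
      generators, so unique existence carries over.\<close>
    moreover have "(\<forall>X\<in>{X. finite X \<and> X \<subseteq> E}. \<forall>u\<in>carr (Cinf_fin X). \<phi> (ell E X u) = eval_at A f X u)
        \<longleftrightarrow> (\<forall>x\<in>E. \<phi> (jmath E x) = f x)" (is "?L \<longleftrightarrow> ?R")
      if \<phi>: "\<phi> \<in> cinf_hom (Cinf_free E) A" for \<phi>
    proof
      assume ?L
      then show ?R using jm by (auto simp: ev_carr eval_at_ev[OF A fX])
    next
      assume R: ?R
      show ?L
      proof (intro ballI, elim CollectE conjE)
        fix X u assume X: "finite X" "X \<subseteq> E" and "u \<in> carr (Cinf_fin X)"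
        then obtain g where g: "g \<in> Cinf (card X)" "u = hat X (enum X) g"
          using carr_Cinf_finE[OF X(1)] by metis
        let ?ev = "\<lambda>i\<in>{..<card X}. ev X (enum X i)"
        have lin: "ell E X \<in> cinf_hom (Cinf_fin X) (Cinf_free E)"
          using lin_hom[of X] X unfolding free by simp
        have ev: "?ev \<in> tuples (card X) (carr (Cinf_fin X))"
          using X by (auto intro!: ev_carr enum_mem)
        have "ell E X (ev X (enum X i)) \<in> carr (Cinf_free E)" if "i < card X" for i
          using lin_closed[of X] X enum_mem[OF X(1) that] unfolding free by (simp add: ev_carr)
        then have "(\<lambda>i\<in>{..<card X}. ell E X (?ev i)) \<in> tuples (card X) (carr (Cinf_free E))"
          by auto
        \<comment> \<open>\<open>u\<close> is the operation \<open>g\<close> applied to evaluations,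
          and both \<open>ell E X\<close> and \<open>\<phi>\<close> commute with it.\<close>
        then have "\<phi> (ell E X u) =
            oper A (card X) g (\<lambda>i\<in>{..<card X}. \<phi> ((\<lambda>i\<in>{..<card X}. ell E X (?ev i)) i))"
          unfolding g(2) hat_eq_oper_ev[OF X(1)] cinf_hom_oper[OF lin g(1) ev]
          by (rule cinf_hom_oper[OF \<phi> g(1)])
        also have "(\<lambda>i\<in>{..<card X}. \<phi> ((\<lambda>i\<in>{..<card X}. ell E X (?ev i)) i)) =
            (\<lambda>i\<in>{..<card X}. f (enum X i))"
        proof (rule restrict_ext)
          fix i assume "i \<in> {..<card X}"
          then have i: "i < card X" "enum X i \<in> X" using enum_mem[OF X(1)] by auto
          then show "\<phi> ((\<lambda>i\<in>{..<card X}. ell E X (?ev i)) i) = f (enum X i)"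
            \<comment> \<open>Read backwards, \<open>jmath_eq\<close> turns the class of an
              evaluation at stage \<open>X\<close> into a value of \<open>jmath E\<close>.\<close>
            using R X(2) by (auto simp flip: jmath_eq[OF X i(2)])
        qed
        finally show "\<phi> (ell E X u) = eval_at A f X u"
          unfolding g(2) eval_at_hat[OF X(1) g(1)] .
      qed
    qed
    \<comment> \<open>The equivalence is available for homomorphisms, so it is rewritten under the
      first conjunct.\<close>
    ultimately show ?thesis by (simp cong: conj_cong)
  qed
  moreover have "jmath E \<in> E \<rightarrow> carr (Cinf_free E)"
    using lin_closed unfolding free by (auto simp: jm ev_carr)
  moreover have "cinf_ring (Cinf_free E)" using ring_L unfolding free .
  ultimately show ?thesis by blast
qed

end
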